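(* For every integer $k\geq 2$, there exists an infinite family of $2k$-ordered simple graphs each of which has minimum degree $2k-1$ and maximum degree $2k+2$.
   Context: All graphs are finite and simple. A simple graph $G$ is $r$-ordered if, for every sequence $v_1, \ldots, v_r$ of $r$ distinct vertices of $G$, there exists a cycle in $G$ containing $v_1, \ldots, v_r$ in this (cyclic) order. *)

theory Defs
  imports "Graph_Theory.Pair_Digraph" "Graph_Theory.Digraph_Isomorphism" "HOL-Library.Sublist"
begin

text \<open>
  A finite simple graph is a \<^locale>\<open>pair_graph\<close>: every edge is represented by its
  two opposite arcs. In this encoding \<^const>\<open>pre_digraph.cycle\<close> also accepts the
  closed walk of length two along an edge and back, which is not a cycle of the undirected
  graph; hence the lower bound on the length.
\<close>

definition graph_cycle :: "'a pair_pre_digraph \<Rightarrow> ('a \<times> 'a) list \<Rightarrow> bool" where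
  "graph_cycle G p \<longleftrightarrow> pre_digraph.cycle (with_proj G) p \<and> 3 \<le> length p"

text \<open>
  For a cycle given as a list of arcs, \<^term>\<open>map fst p\<close> lists its vertices, each of them
  once, in the order of traversal.
\<close>

definition cycle_visits_in_order :: "('a \<times> 'a) list \<Rightarrow> 'a list \<Rightarrow> bool" where
  "cycle_visits_in_order p vs \<longleftrightarrow> (\<exists>n. subseq vs (rotate n (map fst p)))"

definition r_ordered :: "nat \<Rightarrow> 'a pair_pre_digraph \<Rightarrow> bool" where
  "r_ordered r G \<longleftrightarrow>
     (\<forall>vs. length vs = r \<and> distinct vs \<and> set vs \<subseteq> pverts G \<longrightarrow>
        (\<exists>p. graph_cycle G p \<and> cycle_visits_in_order p vs))"

text \<open>The out-degree in the symmetric digraph is the number of neighbours.\<close>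

definition min_degree :: "'a pair_pre_digraph \<Rightarrow> nat" where
  "min_degree G = Min (out_degree (with_proj G) ` pverts G)"

definition max_degree :: "'a pair_pre_digraph \<Rightarrow> nat" where
  "max_degree G = Max (out_degree (with_proj G) ` pverts G)"

end

theory Submission
  imports Defs "HOL-Library.Countable" "HOL-Number_Theory.Cong"
begin

text \<open>
  Start from a bipartite graph of cells without 4-cycles and of large degree: cells are triples
  of a side, an abscissa \<open>x\<close> and an ordinate \<open>y\<close> modulo a prime \<open>p\<close>, and cells on opposite
  sides are adjacent iff \<open>y + y' = x x'\<close>. Blow every cell up to a path whose nodes carry \<open>2k\<close>
  of the edges at the cell each, attach \<open>2k - 1\<close> hubs to ends of such paths, and join
  all hubs to an apex of degree \<open>2k - 1\<close>.

  A node meets \<open>2k + 1\<close> cells, its own one and those of its neighbours in other cells; a hub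
  meets \<open>2k + 1\<close> cells as well. As there are no 4-cycles, each of the other \<open>2k - 1\<close> prescribed
  vertices spoils at most one of them, so every prescribed vertex other than the apex has two cells
  to itself. The apex leaves through a hub that is not prescribed, or directly to the
  next prescribed vertex if that is a hub. Finally, cells can be linked by paths with at most three
  inner cells avoiding any few cells, so that consecutive private cells are linked disjointly.
\<close>

section \<open>Cycles assembled from disjoint connected sets\<close>

definition induced :: "('a \<Rightarrow> 'a \<Rightarrow> bool) \<Rightarrow> 'a set \<Rightarrow> 'a rel" where
  "induced E W = {(u, v). u \<in> W \<and> v \<in> W \<and> E u v}"

lemma induced_mono: "W \<subseteq> W' \<Longrightarrow> induced E W \<subseteq> induced E W'"
  unfolding induced_def by auto

lemma rtrancl_induced_mono: "(u, v) \<in> (induced E W)\<^sup>* \<Longrightarrow> W \<subseteq> W' \<Longrightarrow> (u, v) \<in> (induced E W')\<^sup>*"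
  using rtrancl_mono[OF induced_mono] by blast

lemma rtrancl_induced_sym:
  assumes "(u, v) \<in> (induced E W)\<^sup>*" and "symp E"
  shows "(v, u) \<in> (induced E W)\<^sup>*"
proof -
  have "sym (induced E W)"
    using assms(2) unfolding induced_def sym_def symp_def by auto
  then show ?thesis
    using assms(1) by (meson sym_rtrancl symD)
qed

lemma rtrancl_induced_distinct_path:
  assumes "(u, v) \<in> (induced E W)\<^sup>*"
  shows "\<exists>ws. ws \<noteq> [] \<and> hd ws = u \<and> last ws = v \<and> distinct ws \<and>
    set ws \<subseteq> insert v W \<and> successively E ws"
  using assms
proof (induction rule: converse_rtrancl_induct)
  case base
  show ?case by (intro exI[of _ "[v]"]) auto
next
  case (step u w)
  then obtain ws where ws: "ws \<noteq> []" "hd ws = w" "last ws = v" "distinct ws"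
    "set ws \<subseteq> insert v W" "successively E ws" by blast
  show ?case
  proof (cases "u \<in> set ws")
    case True
    then obtain xs ys where split: "ws = xs @ u # ys" by (meson split_list)
    show ?thesis
      using ws unfolding split
      by (intro exI[of _ "u # ys"]) (auto simp: successively_append_iff)
  next
    case False
    have "u \<in> W" "E u w" using step.hyps(1) unfolding induced_def by auto
    then show ?thesis
      using ws False
      by (intro exI[of _ "u # ws"]) (auto simp: successively_Cons)
  qed
qed

lemma rtrancl_induced_inner_path:
  assumes "(u, v) \<in> (induced E W)\<^sup>*" and "u \<noteq> v"
  shows "\<exists>ms. distinct ms \<and> set ms \<subseteq> W - {u, v} \<and> successively E (u # ms @ [v])"
proof -
  obtain ws where ws: "ws \<noteq> []" "hd ws = u" "last ws = v" "distinct ws"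
    "set ws \<subseteq> insert v W" "successively E ws"
    using rtrancl_induced_distinct_path[OF assms(1)] by blast
  then obtain ws' where ws': "ws = u # ws'" by (cases ws) auto
  with ws assms(2) have "ws' \<noteq> []" "last ws' = v" by auto
  then obtain ms where "ws' = ms @ [v]" by (metis append_butlast_last_id)
  with ws ws' show ?thesis by (intro exI[of _ ms]) auto
qed

lemma cycle_of_disjoint_links:
  fixes vs :: "'a list"
  defines "r \<equiv> length vs"
  assumes dist: "distinct vs" and r: "2 \<le> r"
    and link: "\<And>i. i < r \<Longrightarrow> (vs ! i, vs ! (Suc i mod r)) \<in> (induced E (W i))\<^sup>*"
    and ends: "\<And>i. i < r \<Longrightarrow> set vs \<inter> W i \<subseteq> {vs ! i, vs ! (Suc i mod r)}"
    and disj: "\<And>i j. i < r \<Longrightarrow> j < r \<Longrightarrow> i \<noteq> j \<Longrightarrow> W i \<inter> W j \<subseteq> set vs"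
  shows "\<exists>ws. distinct ws \<and> subseq vs ws \<and> successively E (ws @ [hd ws])"
proof -
  have ne: "vs ! i \<noteq> vs ! (Suc i mod r)" if "i < r" for i
  proof -
    have "Suc i mod r \<noteq> i" using that r by (cases "Suc i = r") auto
    moreover have "Suc i mod r < r" using r by simp
    ultimately show ?thesis using dist that unfolding r_def by (simp add: nth_eq_iff_index_eq)
  qed
  have "\<forall>i. \<exists>ms. i < r \<longrightarrow> distinct ms \<and> set ms \<subseteq> W i - {vs ! i, vs ! (Suc i mod r)} \<and>
      successively E (vs ! i # ms @ [vs ! (Suc i mod r)])"
    using rtrancl_induced_inner_path[OF link ne] by blast
  then obtain ms where ms: "\<And>i. i < r \<Longrightarrow> distinct (ms i)"
    "\<And>i. i < r \<Longrightarrow> set (ms i) \<subseteq> W i - {vs ! i, vs ! (Suc i mod r)}"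
    "\<And>i. i < r \<Longrightarrow> successively E (vs ! i # ms i @ [vs ! (Suc i mod r)])"
    by metis
  define part where "part j = concat (map (\<lambda>i. vs ! i # ms i) [0..<j])" for j
  have inner: "set (ms i) \<inter> set vs = {}" if "i < r" for i
    using ms(2)[OF that] ends[OF that] by blast
  have walk: "successively E (part j @ [vs ! (j mod r)]) \<and>
      subseq (take j vs) (part j) \<and> distinct (part j) \<and>
      (part j \<noteq> [] \<longrightarrow> hd (part j) = vs ! 0) \<and>
      set (part j) = (\<Union>i<j. insert (vs ! i) (set (ms i)))" if "j \<le> r" for j
    using that
  proof (induction j)
    case 0
    show ?case unfolding part_def by simp
  next
    case (Suc j)
    then have j: "j < r" and IH: "successively E (part j @ [vs ! j])" "subseq (take j vs) (part j)"
      "distinct (part j)" "set (part j) = (\<Union>i<j. insert (vs ! i) (set (ms i)))"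
      "part j \<noteq> [] \<longrightarrow> hd (part j) = vs ! 0"
      by auto
    have eq: "part (Suc j) = part j @ vs ! j # ms j" unfolding part_def by simp
    have s: "successively E (part (Suc j) @ [vs ! (Suc j mod r)])"
      using IH(1) ms(3)[OF j] unfolding eq by (auto simp: successively_append_iff)
    have t: "subseq (take (Suc j) vs) (part (Suc j))"
    proof -
      have "subseq [vs ! j] (vs ! j # ms j)" by simp
      then have "subseq (take j vs @ [vs ! j]) (part (Suc j))"
        using IH(2) unfolding eq by (intro list_emb_append_mono)
      then show ?thesis using j unfolding r_def by (simp add: take_Suc_conv_app_nth)
    qed
    have "set (part j) \<inter> set (vs ! j # ms j) = {}"
    proof -
      have "vs ! i \<noteq> vs ! j" if "i < j" for i
        using that j dist unfolding r_def by (simp add: nth_eq_iff_index_eq)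
      moreover have "vs ! j \<in> set vs" "\<And>i. i < j \<Longrightarrow> vs ! i \<in> set vs"
        using j unfolding r_def by auto
      moreover have "set (ms i) \<inter> set (ms j) = {}" if "i < j" for i
        using disj[of i j] ms(2)[of i] ms(2)[OF j] inner[OF j] that j by fastforce
      moreover have "set (ms i) \<inter> set vs = {}" if "i < j" for i
        using inner that j by auto
      ultimately show ?thesis using inner[OF j] unfolding IH(4) by fastforce
    qed
    moreover have "vs ! j \<notin> set (ms j)" using ms(2)[OF j] by auto
    ultimately have d: "distinct (part (Suc j))"
      using IH(3) ms(1)[OF j] unfolding eq by auto
    have h: "hd (part (Suc j)) = vs ! 0"
      using IH(5) unfolding eq by (cases "j = 0") (auto simp: part_def hd_append)
    have "set (part (Suc j)) = (\<Union>i<Suc j. insert (vs ! i) (set (ms i)))"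
      unfolding eq using IH(4) by (auto simp: lessThan_Suc)
    with s t d h show ?case by blast
  qed
  have "part r \<noteq> []" unfolding part_def using r by (auto intro: exI[of _ 0])
  then have "hd (part r) = vs ! (r mod r)" using walk[of r] by simp
  with walk[of r] show ?thesis
    by (intro exI[of _ "part r"]) (auto simp: r_def)
qed

definition image_graph :: "('a \<Rightarrow> 'b) \<Rightarrow> 'a set \<Rightarrow> ('a \<Rightarrow> 'a \<Rightarrow> bool) \<Rightarrow> 'b pair_pre_digraph" where
  "image_graph f V E = \<lparr>pverts = f ` V, parcs = {(f u, f v) | u v. u \<in> V \<and> v \<in> V \<and> E u v}\<rparr>"

lemma pverts_image_graph [simp]: "pverts (image_graph f V E) = f ` V"
  unfolding image_graph_def by simp

lemma pair_graph_image_graph: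
  assumes "finite V" and "symp E" and "irreflp E" and "inj f"
  shows "pair_graph (image_graph f V E)"
proof
  let ?G = "image_graph f V E"
  show "finite (pverts ?G)" using assms(1) by simp
  have "parcs ?G \<subseteq> f ` V \<times> f ` V" unfolding image_graph_def by auto
  then show "finite (parcs ?G)" using assms(1) by (meson finite_SigmaI finite_imageI finite_subset)
  show "symmetric (with_proj ?G)"
    using assms(2) unfolding symmetric_def image_graph_def sym_def symp_def by auto
qed (use assms in \<open>auto simp: image_graph_def irreflp_def inj_eq\<close>)

lemma out_degree_image_graph:
  assumes "inj f" and "v \<in> V"
  shows "out_degree (with_proj (image_graph f V E)) (f v) = card {w \<in> V. E v w}"
proof -
  have "out_arcs (with_proj (image_graph f V E)) (f v) = (\<lambda>w. (f v, f w)) ` {w \<in> V. E v w}"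
    using assms by (auto simp: out_arcs_def image_graph_def inj_eq)
  moreover have "inj_on (\<lambda>w. (f v, f w)) {w \<in> V. E v w}"
    using assms(1) by (auto simp: inj_on_def dest: injD)
  ultimately show ?thesis unfolding out_degree_def by (simp add: card_image)
qed

lemma pcas_zip:
  "ws \<noteq> [] \<Longrightarrow> pcas (hd ws) (zip ws (tl ws @ [v])) v"
  "ws \<noteq> [] \<Longrightarrow> pawalk_verts (hd ws) (zip ws (tl ws @ [v])) = ws @ [v]"
proof (induction ws)
  case (Cons w ws)
  { case 1 then show ?case using Cons.IH(1) by (cases ws) auto }
  { case 2 then show ?case using Cons.IH(2) by (cases ws) auto }
qed auto

lemma successively_zip:
  "successively E (ws @ [v]) \<Longrightarrow> (x, y) \<in> set (zip ws (tl ws @ [v])) \<Longrightarrow> E x y"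
proof (induction ws)
  case (Cons w ws)
  then show ?case by (cases ws) auto
qed simp

lemma graph_cycle_of_vertex_list:
  assumes "distinct ws" and "3 \<le> length ws" and "set ws \<subseteq> pverts G"
    and "successively (\<lambda>x y. (x, y) \<in> parcs G) (ws @ [hd ws])"
  shows "\<exists>p. graph_cycle G p \<and> map fst p = ws"
proof -
  let ?p = "zip ws (tl ws @ [hd ws])"
  have ne: "ws \<noteq> []" using assms(2) by auto
  have len: "length (tl ws @ [hd ws]) = length ws" using ne by simp
  have arcs: "set ?p \<subseteq> parcs G" using successively_zip[OF assms(4)] by auto
  have "distinct (tl (ws @ [hd ws]))" using assms(1) ne by (cases ws) auto
  then have "pre_digraph.cycle (with_proj G) ?p"
    unfolding pre_digraph.cycle_def pre_digraph.awalk_def cas_with_proj_eq awalk_verts_with_proj_eq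
    using pcas_zip[OF ne, of "hd ws"] arcs ne assms(2,3) len
    by (intro exI[of _ "hd ws"]) auto
  then show ?thesis
    unfolding graph_cycle_def using assms(2) len
    by (intro exI[of _ ?p]) (auto simp: map_fst_zip)
qed

lemma r_ordered_image_graph:
  assumes "inj f" and "3 \<le> r" and closed: "\<And>u v. E u v \<Longrightarrow> u \<in> V \<and> v \<in> V"
    and cyc: "\<And>vs. length vs = r \<Longrightarrow> distinct vs \<Longrightarrow> set vs \<subseteq> V \<Longrightarrow>
      \<exists>ws. distinct ws \<and> subseq vs ws \<and> successively E (ws @ [hd ws])"
  shows "r_ordered r (image_graph f V E)"
  unfolding r_ordered_def
proof (intro allI impI, elim conjE)
  let ?G = "image_graph f V E"
  fix us assume us: "length us = r" "distinct us" "set us \<subseteq> pverts ?G"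
  define vs where "vs = map (inv f) us"
  have us_eq: "us = map f vs"
    using us(3) unfolding vs_def by (induction us) (auto simp: f_inv_into_f)
  have "length vs = r" "distinct vs" "set vs \<subseteq> V"
    using us us_eq assms(1) by (auto simp: distinct_map dest: injD)
  then obtain ws where ws: "distinct ws" "subseq vs ws" "successively E (ws @ [hd ws])"
    using cyc by blast
  have len: "3 \<le> length ws" using list_emb_length[OF ws(2)] \<open>length vs = r\<close> assms(2) by simp
  then have ne: "ws \<noteq> []" by auto
  have sub: "set ws \<subseteq> V"
  proof
    fix x assume "x \<in> set ws"
    then obtain i where "i < length ws" "x = ws ! i" by (metis in_set_conv_nth)
    then have "(x, (tl ws @ [hd ws]) ! i) \<in> set (zip ws (tl ws @ [hd ws]))"
      using ne by (auto simp: in_set_zip)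
    from successively_zip[OF ws(3) this] show "x \<in> V" using closed by blast
  qed
  have "successively (\<lambda>x y. (f x, f y) \<in> parcs ?G) (ws @ [hd ws])"
    by (rule successively_mono[OF ws(3)]) (use closed in \<open>auto simp: image_graph_def\<close>)
  then have "successively (\<lambda>x y. (x, y) \<in> parcs ?G) (map f (ws @ [hd ws]))"
    by (simp only: successively_map)
  then have "successively (\<lambda>x y. (x, y) \<in> parcs ?G) (map f ws @ [hd (map f ws)])"
    using ne by (simp add: hd_map)
  then obtain p where p: "graph_cycle ?G p" "map fst p = map f ws"
    using graph_cycle_of_vertex_list[of "map f ws" ?G] ws(1) sub len assms(1)
    by (auto simp: distinct_map inj_on_def)
  have "subseq us (rotate 0 (map fst p))"
    using subseq_map[OF ws(2), of f] p(2) us_eq by simp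
  with p(1) show "\<exists>p. graph_cycle ?G p \<and> cycle_visits_in_order p us"
    unfolding cycle_visits_in_order_def by blast
qed

lemma digraph_iso_card_verts:
  assumes "digraph_iso G H"
  shows "card (verts G) = card (verts H)"
proof -
  obtain f where f: "pre_digraph.digraph_isomorphism G f" "H = app_iso f G"
    using assms unfolding digraph_iso_def by blast
  then have "inj_on (iso_verts f) (verts G)" "verts H = iso_verts f ` verts G"
    by (auto simp: pre_digraph.digraph_isomorphism_def app_iso_def)
  then show ?thesis by (simp add: card_image)
qed

section \<open>The cell graph\<close>

datatype cell = Cell (side: bool) (absc: nat) (ordn: nat)

datatype vert = Node cell nat | Hub nat | Apex

instance cell :: countable by countable_datatype
instance vert :: countable by countable_datatype

locale cell_plane =
  fixes k p :: nat
  assumes k: "2 \<le> k" and prime_p: "prime p" and p_large: "40 * k \<le> p"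
begin

definition n :: nat where "n = p div (2 * k)"
definition M :: nat where "M = 2 * k * n"

text \<open>
  Only cells with abscissa below \<^term>\<open>M\<close> carry vertices, so that the number of neighbours of a
  cell is divisible by \<open>2k\<close>; the full plane provides common neighbours.
\<close>

definition plane :: "cell set" where
  "plane = {c. absc c < p \<and> ordn c < p}"

definition cells :: "cell set" where
  "cells = {c \<in> plane. absc c < M}"

definition cadj :: "cell \<Rightarrow> cell \<Rightarrow> bool" where
  "cadj c d \<longleftrightarrow> c \<in> plane \<and> d \<in> plane \<and> side c \<noteq> side d \<and>
     [ordn c + ordn d = absc c * absc d] (mod p)"

lemma p_pos: "0 < p"
  using prime_p by (simp add: prime_gt_0_nat)

lemma M_le: "M \<le> p" and M_gt: "p < M + 2 * k" and n_ge: "2 \<le> n" and M_large: "38 * k < M"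
proof -
  have *: "p = 2 * k * n + p mod (2 * k)" unfolding n_def by simp
  have **: "p mod (2 * k) < 2 * k" using k by simp
  show "M \<le> p" "p < M + 2 * k" using * ** unfolding M_def by linarith+
  then show "38 * k < M" using p_large by linarith
  then have "2 * k * 2 \<le> 2 * k * n" unfolding M_def by linarith
  then show "2 \<le> n" using k by simp
qed

lemma cells_plane: "cells \<subseteq> plane"
  unfolding cells_def by auto

lemma finite_plane: "finite plane"
proof -
  have "plane \<subseteq> (\<lambda>(s, x, y). Cell s x y) ` (UNIV \<times> {..<p} \<times> {..<p})"
  proof
    fix c assume "c \<in> plane"
    then show "c \<in> (\<lambda>(s, x, y). Cell s x y) ` (UNIV \<times> {..<p} \<times> {..<p})"
      unfolding plane_def by (cases c) force
  qed
  then show ?thesis by (rule finite_subset) auto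
qed

lemma finite_cells: "finite cells"
  using finite_plane cells_plane finite_subset by blast

lemma cadj_sym: "cadj c d \<longleftrightarrow> cadj d c"
  unfolding cadj_def by (auto simp: add.commute mult.commute)

lemma cadj_side: "cadj c d \<Longrightarrow> side c \<noteq> side d"
  and cadj_plane: "cadj c d \<Longrightarrow> c \<in> plane" "cadj c d \<Longrightarrow> d \<in> plane"
  unfolding cadj_def by auto

lemma cong_imp_eq: "[a = b] (mod p) \<Longrightarrow> a < p \<Longrightarrow> b < p \<Longrightarrow> a = (b :: nat)"
  by (simp add: cong_less_modulus_unique_nat)

lemma int_cadj:
  "cadj c d \<Longrightarrow> [int (ordn c) + int (ordn d) = int (absc c) * int (absc d)] (mod int p)"
  unfolding cadj_def by (metis cong_int_iff of_nat_add of_nat_mult)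

lemma prime_dvd_prod_nats:
  assumes "int p dvd (int a - int b) * (int c - int d)" "a < p" "b < p" "c < p" "d < p"
  shows "a = b \<or> c = d"
proof -
  have *: "a = b" if "int p dvd (int a - int b)" "a < p" "b < p" for a b
    using that by (metis cong_iff_dvd_diff cong_imp_eq cong_int_iff)
  have "prime (int p)" using prime_p by simp
  then have "int p dvd (int a - int b) \<or> int p dvd (int c - int d)"
    using assms(1) prime_dvd_mult_iff by blast
  then show ?thesis using * assms by blast
qed

lemma cadj_unique_at:
  assumes "cadj c d" "cadj c d'" "absc d = absc d'"
  shows "d = d'"
proof -
  have "[ordn c + ordn d = ordn c + ordn d'] (mod p)"
    using assms unfolding cadj_def by (metis cong_sym cong_trans)
  then have "[ordn d = ordn d'] (mod p)" by (simp add: cong_add_lcancel_nat)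
  then have "ordn d = ordn d'"
    using assms cong_imp_eq unfolding cadj_def plane_def by auto
  moreover have "side d = side d'" using assms cadj_side by auto
  ultimately show ?thesis using assms(3) by (simp add: cell.expand)
qed

lemma no_four_cycle:
  assumes "cadj c d" "cadj c d'" "cadj c' d" "cadj c' d'"
  shows "c = c' \<or> d = d'"
proof -
  let ?m = "int p"
  define a b a' b' where "a = int (absc c)" "b = int (absc d)" "a' = int (absc c')" "b' = int (absc d')"
  define A B A' B' where "A = int (ordn c)" "B = int (ordn d)" "A' = int (ordn c')" "B' = int (ordn d')"
  note defs = a_b_a'_b'_def A_B_A'_B'_def
  have h: "?m dvd (A + B) - a * b" "?m dvd (A + B') - a * b'"
    "?m dvd (A' + B) - a' * b" "?m dvd (A' + B') - a' * b'"
    using assms[THEN int_cadj] unfolding defs cong_iff_dvd_diff by auto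
  have "?m dvd ((A + B') - a * b') - ((A + B) - a * b) + (((A' + B) - a' * b) - ((A' + B') - a' * b'))"
    by (rule dvd_add[OF dvd_diff[OF h(2,1)] dvd_diff[OF h(3,4)]])
  also have "((A + B') - a * b') - ((A + B) - a * b) + (((A' + B) - a' * b) - ((A' + B') - a' * b'))
    = (a - a') * (b - b')" by (simp add: algebra_simps)
  finally have "absc c = absc c' \<or> absc d = absc d'"
    unfolding defs using assms[THEN cadj_plane(1)] assms[THEN cadj_plane(2)]
    by (intro prime_dvd_prod_nats) (auto simp: plane_def)
  then show ?thesis
  proof
    assume "absc c = absc c'"
    then show ?thesis using cadj_unique_at[of d c c'] assms cadj_sym by blast
  next
    assume "absc d = absc d'"
    then show ?thesis using cadj_unique_at[of c d d'] assms by blast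
  qed
qed

definition nbr :: "cell \<Rightarrow> nat \<Rightarrow> cell" where
  "nbr c x = Cell (\<not> side c) x ((absc c * x + (p - ordn c)) mod p)"

lemma absc_nbr [simp]: "absc (nbr c x) = x"
  unfolding nbr_def by simp

lemma cadj_nbr:
  assumes "c \<in> plane" "x < p"
  shows "cadj c (nbr c x)"
proof -
  have "[ordn c + (absc c * x + (p - ordn c)) mod p = ordn c + (absc c * x + (p - ordn c))] (mod p)"
    by (intro cong_add) (auto simp: cong_def)
  also have "ordn c + (absc c * x + (p - ordn c)) = absc c * x + p"
    using assms unfolding plane_def by auto
  also have "[absc c * x + p = absc c * x] (mod p)" by (simp add: cong_def)
  finally show ?thesis
    using assms p_pos unfolding cadj_def nbr_def plane_def by auto
qed

lemma cadj_iff_nbr: "c \<in> plane \<Longrightarrow> cadj c d \<longleftrightarrow> absc d < p \<and> d = nbr c (absc d)"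
  using cadj_nbr[of c "absc d"] cadj_unique_at[of c "nbr c (absc d)" d] cadj_plane(2)[of c d]
  unfolding plane_def by auto

lemma nbr_in_cells: "c \<in> plane \<Longrightarrow> x < M \<Longrightarrow> nbr c x \<in> cells"
  using cadj_nbr[of c x] cadj_plane(2) M_le unfolding cells_def by auto

lemma inj_nbr: "inj (nbr c)"
  by (rule injI) (metis absc_nbr)

lemma common_nbr:
  assumes "c \<in> plane" "d \<in> plane" "side c = side d" "absc c \<noteq> absc d"
  shows "\<exists>e. cadj c e \<and> cadj e d"
proof -
  let ?m = "int p"
  have cop: "coprime (int (absc c) - int (absc d)) ?m"
  proof -
    have "\<not> ?m dvd int (absc c) - int (absc d)"
      using assms prime_dvd_prod_nats[of "absc c" "absc d" 1 0] p_pos prime_p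
      unfolding plane_def by (auto simp: prime_gt_1_nat)
    then show ?thesis using prime_p by (metis prime_imp_coprime coprime_commute prime_int_nat_transfer prime_nat_int_transfer)
  qed
  then obtain x where x: "[(int (absc c) - int (absc d)) * x = 1] (mod ?m)"
    using cong_solve_coprime_int by blast
  define w where "w = nat ((x * (int (ordn c) - int (ordn d))) mod ?m)"
  have w: "int w = (x * (int (ordn c) - int (ordn d))) mod ?m" "w < p"
    unfolding w_def using p_pos by (auto simp: nat_less_iff)
  have "[(int (absc c) - int (absc d)) * int w = (int (absc c) - int (absc d)) * (x * (int (ordn c) - int (ordn d)))] (mod ?m)"
    unfolding w(1) by (intro cong_mult) (auto simp: cong_def)
  also have "(int (absc c) - int (absc d)) * (x * (int (ordn c) - int (ordn d))) =
     (int (absc c) - int (absc d)) * x * (int (ordn c) - int (ordn d))" by simp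
  also have "[\<dots> = 1 * (int (ordn c) - int (ordn d))] (mod ?m)"
    by (intro cong_mult x) auto
  finally have A: "?m dvd (int (absc c) - int (absc d)) * int w - (int (ordn c) - int (ordn d))"
    by (simp add: cong_iff_dvd_diff)
  let ?e = "nbr c w"
  have e: "cadj c ?e" using cadj_nbr assms(1) w(2) by simp
  have B: "?m dvd (int (ordn c) + int (ordn ?e)) - int (absc c) * int w"
    using int_cadj[OF e] by (simp add: cong_iff_dvd_diff)
  have "?m dvd ((int (absc c) - int (absc d)) * int w - (int (ordn c) - int (ordn d)))
     + ((int (ordn c) + int (ordn ?e)) - int (absc c) * int w)"
    by (rule dvd_add[OF A B])
  also have "\<dots> = (int (ordn ?e) + int (ordn d)) - int w * int (absc d)"
    by (simp add: algebra_simps)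
  finally have "[ordn ?e + ordn d = absc ?e * absc d] (mod p)"
    by (metis absc_nbr cong_iff_dvd_diff cong_int_iff of_nat_add of_nat_mult)
  then have "cadj ?e d"
    using e assms unfolding cadj_def by auto
  with e show ?thesis by blast
qed

lemma link_opposite_cells:
  assumes a: "a \<in> cells" and b: "b \<in> cells" and sides: "side a \<noteq> side b"
    and F: "finite F" "2 * card F + 2 * k + 1 < M"
  shows "\<exists>I. I \<subseteq> cells \<and> I \<inter> F = {} \<and> card I \<le> 2 \<and>
    (a, b) \<in> (induced cadj (insert a (insert b I)))\<^sup>*"
proof (cases "cadj a b")
  case True
  then show ?thesis
    by (intro exI[of _ "{}"]) (auto simp: induced_def)
next
  case False
  have ap: "a \<in> plane" and bp: "b \<in> plane" using a b cells_plane by auto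
  define X where "X = {..<M} - {absc b}"
  have c: "cadj a (nbr a x)" "nbr a x \<in> cells" if "x < M" for x
    using that ap cadj_nbr nbr_in_cells M_le by auto
  have "\<forall>x\<in>X. \<exists>e. cadj (nbr a x) e \<and> cadj e b"
  proof
    fix x assume x: "x \<in> X"
    then have "side (nbr a x) = side b" using sides by (simp add: nbr_def)
    moreover have "nbr a x \<in> plane" using x c cells_plane unfolding X_def by auto
    ultimately show "\<exists>e. cadj (nbr a x) e \<and> cadj e b"
      using x by (intro common_nbr bp) (auto simp: X_def)
  qed
  then obtain D where D: "\<And>x. x \<in> X \<Longrightarrow> cadj (nbr a x) (D x)" "\<And>x. x \<in> X \<Longrightarrow> cadj (D x) b"
    by metis
  have inj: "inj_on D X"
  proof (rule inj_onI)
    fix x x' assume x: "x \<in> X" "x' \<in> X" "D x = D x'"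
    have "cadj (D x) (nbr a x)" "cadj (D x) (nbr a x')" using D x cadj_sym by metis+
    then have "a = D x \<or> nbr a x = nbr a x'"
      using no_four_cycle[of a "nbr a x" "nbr a x'" "D x"] c x unfolding X_def by auto
    moreover have "a \<noteq> D x" using D(2) x False by auto
    ultimately show "x = x'" by (metis absc_nbr)
  qed
  define bad1 where "bad1 = {x \<in> X. nbr a x \<in> F}"
  define bad2 where "bad2 = {x \<in> X. D x \<in> F \<union> nbr b ` {M..<p}}"
  have "card bad1 \<le> card F"
    by (rule card_inj_on_le[of "nbr a"])
      (use F inj_nbr in \<open>auto simp: bad1_def intro: inj_on_subset\<close>)
  moreover have "card bad2 \<le> card F + 2 * k"
  proof -
    have "card bad2 \<le> card (F \<union> nbr b ` {M..<p})"
      by (rule card_inj_on_le[of D]) (use F in \<open>auto simp: bad2_def intro: inj_on_subset[OF inj]\<close>)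
    also have "\<dots> \<le> card F + card (nbr b ` {M..<p})" by (rule card_Un_le)
    also have "card (nbr b ` {M..<p}) \<le> card {M..<p}" by (rule card_image_le) simp
    also have "card {M..<p} \<le> 2 * k" using M_gt by simp
    finally show ?thesis by simp
  qed
  ultimately have "card (bad1 \<union> bad2) \<le> 2 * card F + 2 * k"
    using card_Un_le[of bad1 bad2] by linarith
  also have "\<dots> < card X"
  proof -
    have "M - 1 \<le> card X" unfolding X_def using card_Diff1_le[of "{..<M}" "absc b"]
      by (cases "absc b < M") auto
    then show ?thesis using F(2) by linarith
  qed
  finally have "\<not> X \<subseteq> bad1 \<union> bad2"
    using card_mono[of "bad1 \<union> bad2" X] unfolding bad1_def bad2_def X_def by auto
  then obtain x where x: "x \<in> X" "nbr a x \<notin> F" "D x \<notin> F" "D x \<notin> nbr b ` {M..<p}"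
    unfolding bad1_def bad2_def by auto
  have Dc: "D x \<in> cells"
  proof -
    have "cadj b (D x)" using D(2) x(1) cadj_sym by blast
    then have "D x \<in> plane" "D x = nbr b (absc (D x))" "absc (D x) < p"
      using cadj_iff_nbr[OF bp] cadj_plane(2) by blast+
    then show ?thesis using x(4) unfolding cells_def by (force simp: not_less)
  qed
  let ?I = "{nbr a x, D x}"
  have "(a, nbr a x) \<in> induced cadj (insert a (insert b ?I))"
    "(nbr a x, D x) \<in> induced cadj (insert a (insert b ?I))"
    "(D x, b) \<in> induced cadj (insert a (insert b ?I))"
    using c D x(1) unfolding induced_def X_def by auto
  then have "(a, b) \<in> (induced cadj (insert a (insert b ?I)))\<^sup>*"
    by (meson converse_rtrancl_into_rtrancl r_into_rtrancl)
  moreover have "?I \<subseteq> cells" "?I \<inter> F = {}"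
    using c(2)[of x] x Dc unfolding X_def by auto
  moreover have "card ?I \<le> 2" by (simp add: card_insert_if)
  ultimately show ?thesis by blast
qed

lemma link_cells:
  assumes a: "a \<in> cells" and b: "b \<in> cells"
    and F: "finite F" "2 * card F + 2 * k + 1 < M"
  shows "\<exists>I. I \<subseteq> cells \<and> I \<inter> F = {} \<and> card I \<le> 3 \<and>
    (a, b) \<in> (induced cadj (insert a (insert b I)))\<^sup>*"
proof (cases "side a = side b")
  case False
  then show ?thesis using link_opposite_cells[OF a b False F]
    by (metis le_trans numeral_le_iff semiring_norm(68,69,72))
next
  case True
  have ap: "a \<in> plane" using a cells_plane by auto
  have "card {x \<in> {..<M}. nbr a x \<in> F} \<le> card F"
    by (rule card_inj_on_le[of "nbr a"]) (use F inj_nbr in \<open>auto intro: inj_on_subset\<close>)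
  then have "\<not> {..<M} \<subseteq> {x \<in> {..<M}. nbr a x \<in> F}"
    using F(2) card_mono[of "{x \<in> {..<M}. nbr a x \<in> F}" "{..<M}"] by auto
  then obtain x where x: "x < M" "nbr a x \<notin> F" by auto
  have c: "nbr a x \<in> cells" "cadj a (nbr a x)" using nbr_in_cells cadj_nbr ap x M_le by auto
  then have "side (nbr a x) \<noteq> side b" using True cadj_side by blast
  then obtain I where I: "I \<subseteq> cells" "I \<inter> F = {}" "card I \<le> 2"
    "(nbr a x, b) \<in> (induced cadj (insert (nbr a x) (insert b I)))\<^sup>*"
    using link_opposite_cells[OF c(1) b _ F] by blast
  let ?I = "insert (nbr a x) I"
  have "(a, nbr a x) \<in> induced cadj (insert a (insert b ?I))"
    using c unfolding induced_def by auto
  moreover have "(nbr a x, b) \<in> (induced cadj (insert a (insert b ?I)))\<^sup>*"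
    by (rule rtrancl_induced_mono[OF I(4)]) auto
  ultimately have "(a, b) \<in> (induced cadj (insert a (insert b ?I)))\<^sup>*"
    by (rule converse_rtrancl_into_rtrancl)
  moreover have "card ?I \<le> 3" using I(3) card_insert_le_m1[of 3 I "nbr a x"] by simp
  ultimately show ?thesis using I c x by (intro exI[of _ ?I]) auto
qed

lemma disjoint_cell_links:
  assumes "\<And>i. i < m \<Longrightarrow> a i \<in> cells" and "\<And>i. i < m \<Longrightarrow> b i \<in> cells"
    and "finite F" and "2 * (card F + 3 * m) + 2 * k + 1 < M"
  shows "\<exists>I. (\<forall>i<m. I i \<subseteq> cells \<and> I i \<inter> F = {} \<and> card (I i) \<le> 3 \<and>
      (a i, b i) \<in> (induced cadj (insert (a i) (insert (b i) (I i))))\<^sup>*) \<and>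
      (\<forall>i<m. \<forall>j<m. i \<noteq> j \<longrightarrow> I i \<inter> I j = {})"
  using assms
proof (induction m)
  case 0
  then show ?case by auto
next
  case (Suc m)
  then obtain I where I: "\<And>i. i < m \<Longrightarrow> I i \<subseteq> cells \<and> I i \<inter> F = {} \<and> card (I i) \<le> 3 \<and>
      (a i, b i) \<in> (induced cadj (insert (a i) (insert (b i) (I i))))\<^sup>*"
      "\<And>i j. i < m \<Longrightarrow> j < m \<Longrightarrow> i \<noteq> j \<Longrightarrow> I i \<inter> I j = {}"
    by force
  let ?F = "F \<union> (\<Union>i<m. I i)"
  have fin: "finite ?F"
    using Suc.prems(3) I(1) finite_cells by (auto intro: finite_subset)
  have "card (\<Union>i<m. I i) \<le> (\<Sum>i<m. card (I i))" by (rule card_UN_le) simp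
  also have "\<dots> \<le> (\<Sum>i<m. 3)" using I(1) by (intro sum_mono) auto
  finally have "card ?F \<le> card F + 3 * m" using card_Un_le[of F "\<Union>i<m. I i"] by simp
  then have "2 * card ?F + 2 * k + 1 < M" using Suc.prems(4) by simp
  then obtain J where J: "J \<subseteq> cells" "J \<inter> ?F = {}" "card J \<le> 3"
    "(a m, b m) \<in> (induced cadj (insert (a m) (insert (b m) J)))\<^sup>*"
    using link_cells[of "a m" "b m" ?F] Suc.prems(1,2) fin by blast
  have "J \<inter> I i = {}" if "i < m" for i using J(2) that by auto
  with I J show ?case
    by (intro exI[of _ "I(m := J)"]) (auto simp: less_Suc_eq)
qed

end

section \<open>Blowing up cells to paths\<close>

context cell_plane
begin

fun adj :: "vert \<Rightarrow> vert \<Rightarrow> bool" where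
  "adj (Node c s) (Node d t) \<longleftrightarrow> c \<in> cells \<and> d \<in> cells \<and> s < n \<and> t < n \<and>
     (c = d \<and> (t = Suc s \<or> s = Suc t) \<or>
      cadj c d \<and> s = absc d div (2 * k) \<and> t = absc c div (2 * k))"
| "adj (Node c s) (Hub b) \<longleftrightarrow> b < 2 * k - 1 \<and> s = 0 \<and> c \<in> Cell False b ` {..2 * k}"
| "adj (Hub b) (Node c s) \<longleftrightarrow> b < 2 * k - 1 \<and> s = 0 \<and> c \<in> Cell False b ` {..2 * k}"
| "adj (Hub b) Apex \<longleftrightarrow> b < 2 * k - 1"
| "adj Apex (Hub b) \<longleftrightarrow> b < 2 * k - 1"
| "adj _ _ \<longleftrightarrow> False"

definition V :: "vert set" where
  "V = (\<lambda>(c, s). Node c s) ` (cells \<times> {..<n}) \<union> Hub ` {..<2 * k - 1} \<union> {Apex}"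

lemma in_V [simp]:
  "Node c s \<in> V \<longleftrightarrow> c \<in> cells \<and> s < n" "Hub b \<in> V \<longleftrightarrow> b < 2 * k - 1" "Apex \<in> V"
  unfolding V_def by auto

lemma finite_V: "finite V"
  unfolding V_def using finite_cells by auto

lemma symp_adj: "symp adj"
proof (rule sympI)
  fix u v show "adj u v \<Longrightarrow> adj v u"
    by (cases u; cases v) (auto simp: cadj_sym)
qed

lemma irreflp_adj: "irreflp adj"
proof (rule irreflpI)
  fix u show "\<not> adj u u"
    by (cases u) (auto dest: cadj_side)
qed

lemma hub_cells: "b < 2 * k - 1 \<Longrightarrow> Cell False b ` {..2 * k} \<subseteq> cells"
  using M_large p_large M_le k unfolding cells_def plane_def by auto

lemma adj_in_V: "adj u v \<Longrightarrow> u \<in> V \<and> v \<in> V"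
  using n_ge hub_cells by (cases u; cases v) fastforce+

definition block :: "cell \<Rightarrow> nat \<Rightarrow> cell set" where
  "block c s = {d \<in> cells. cadj c d \<and> absc d div (2 * k) = s}"

lemma div_eq_interval: "x div (2 * k) = s \<longleftrightarrow> x \<in> {2 * k * s..<2 * k * s + 2 * k}"
proof
  assume "x div (2 * k) = s"
  then have "x = 2 * k * s + x mod (2 * k)" by auto
  moreover have "x mod (2 * k) < 2 * k" using k by simp
  ultimately show "x \<in> {2 * k * s..<2 * k * s + 2 * k}" unfolding atLeastLessThan_iff by linarith
qed (auto intro: div_nat_eqI simp: algebra_simps)

lemma card_block:
  assumes "c \<in> cells" "s < n"
  shows "card (block c s) = 2 * k"
proof -
  have cp: "c \<in> plane" using assms cells_plane by auto
  have "2 * k * Suc s \<le> M" unfolding M_def using assms(2) by (intro mult_le_mono2) simp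
  then have lt: "x < M" if "x \<in> {2 * k * s..<2 * k * s + 2 * k}" for x
    using that by simp
  have "block c s = nbr c ` {2 * k * s..<2 * k * s + 2 * k}"
  proof (intro equalityI subsetI)
    fix d assume "d \<in> block c s"
    then have "d = nbr c (absc d)" "absc d \<in> {2 * k * s..<2 * k * s + 2 * k}"
      unfolding block_def using cadj_iff_nbr[OF cp] div_eq_interval by auto
    then show "d \<in> nbr c ` {2 * k * s..<2 * k * s + 2 * k}" by (rule image_eqI)
  next
    fix d assume "d \<in> nbr c ` {2 * k * s..<2 * k * s + 2 * k}"
    then obtain x where x: "x \<in> {2 * k * s..<2 * k * s + 2 * k}" "d = nbr c x" by auto
    then have "x < p" using lt M_le by (meson le_trans less_le_trans)
    with x lt show "d \<in> block c s"
      unfolding block_def using cadj_nbr[OF cp] nbr_in_cells[OF cp] div_eq_interval by auto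
  qed
  then show ?thesis by (simp add: card_image inj_on_subset[OF inj_nbr])
qed

lemma absc_div_less: "c \<in> cells \<Longrightarrow> absc c div (2 * k) < n"
  using k unfolding cells_def M_def by (simp add: div_less_iff_less_mult mult.commute)

lemma degree_node:
  assumes "Node c s \<in> V"
  shows "2 * k \<le> card {w \<in> V. adj (Node c s) w}" and "card {w \<in> V. adj (Node c s) w} \<le> 2 * k + 2"
proof -
  let ?N = "{w \<in> V. adj (Node c s) w}"
  let ?B = "(\<lambda>d. Node d (absc c div (2 * k))) ` block c s"
  have cs: "c \<in> cells" "s < n" using assms by auto
  have "?B \<subseteq> ?N" using cs absc_div_less[OF cs(1)] unfolding block_def by auto
  have cB: "card ?B = 2 * k" using card_block[OF cs] by (simp add: card_image inj_on_def)
  have "finite ?N" using finite_V by auto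
  with \<open>?B \<subseteq> ?N\<close> cB show "2 * k \<le> card ?N" by (metis card_mono)
  have "?N \<subseteq> ?B \<union> {Node c (Suc s), if s = 0 then Hub (absc c) else Node c (s - 1)}"
  proof
    fix w assume "w \<in> ?N"
    then show "w \<in> ?B \<union> {Node c (Suc s), if s = 0 then Hub (absc c) else Node c (s - 1)}"
      by (cases w) (auto simp: block_def)
  qed
  then have "card ?N \<le> card (?B \<union> {Node c (Suc s), if s = 0 then Hub (absc c) else Node c (s - 1)})"
    by (rule card_mono[rotated]) (auto simp: block_def finite_cells)
  also have "\<dots> \<le> card ?B + 2"
    by (rule order_trans[OF card_Un_le]) (auto simp: card_insert_if)
  finally show "card ?N \<le> 2 * k + 2" using cB by simp
qed

lemma degree_hub:
  assumes "b < 2 * k - 1"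
  shows "card {w \<in> V. adj (Hub b) w} = 2 * k + 2"
proof -
  have "{w \<in> V. adj (Hub b) w} = insert Apex ((\<lambda>y. Node (Cell False b y) 0) ` {..2 * k})"
  proof (intro equalityI subsetI)
    fix w assume "w \<in> {w \<in> V. adj (Hub b) w}"
    then show "w \<in> insert Apex ((\<lambda>y. Node (Cell False b y) 0) ` {..2 * k})" by (cases w) auto
  next
    fix w assume "w \<in> insert Apex ((\<lambda>y. Node (Cell False b y) 0) ` {..2 * k})"
    then have "adj (Hub b) w" using assms by auto
    then show "w \<in> {w \<in> V. adj (Hub b) w}" using adj_in_V by blast
  qed
  moreover have "card ((\<lambda>y. Node (Cell False b y) 0) ` {..2 * k}) = 2 * k + 1"
    by (subst card_image) (auto simp: inj_on_def)
  ultimately show ?thesis by (auto simp: card_insert_if)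
qed

lemma degree_apex: "card {w \<in> V. adj Apex w} = 2 * k - 1"
proof -
  have "{w \<in> V. adj Apex w} = Hub ` {..<2 * k - 1}"
  proof (intro equalityI subsetI)
    fix w assume "w \<in> {w \<in> V. adj Apex w}"
    then show "w \<in> Hub ` {..<2 * k - 1}" by (cases w) auto
  qed auto
  then show ?thesis by (simp add: card_image inj_on_def)
qed

end

section \<open>Private cells and linking\<close>

context cell_plane
begin

fun home :: "vert \<Rightarrow> cell set" where
  "home (Node c s) = {c}"
| "home (Hub b) = {}"
| "home Apex = {}"

text \<open>The cells through which a path may leave a vertex.\<close>

fun cand :: "vert \<Rightarrow> cell set" where
  "cand (Node c s) = insert c (block c s)"
| "cand (Hub b) = Cell False b ` {..2 * k}"
| "cand Apex = {}"

lemma cand_cells: "v \<in> V \<Longrightarrow> cand v \<subseteq> cells"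
  using hub_cells by (cases v) (auto simp: block_def)

lemma card_cand:
  assumes "v \<in> V" "v \<noteq> Apex"
  shows "card (cand v) = 2 * k + 1"
proof (cases v)
  case (Node c s)
  have "c \<notin> block c s" unfolding block_def using cadj_side by blast
  moreover have "finite (block c s)" unfolding block_def using finite_cells by simp
  ultimately show ?thesis using Node assms card_block by simp
next
  case (Hub b)
  then show ?thesis by (simp add: card_image inj_on_def)
qed (use assms in simp)

text \<open>
  The cells that a prescribed vertex \<open>u\<close> spoils for \<open>v\<close>. The home of \<open>v\<close> is not among the cells
  claimed by \<open>u\<close>, since \<open>u\<close> is itself barred from it.
\<close>

definition conflict :: "vert \<Rightarrow> vert \<Rightarrow> cell set" where
  "conflict u v = cand v \<inter> (home u \<union> (cand u - home v))"

lemma conflict_unique: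
  assumes "u \<noteq> v" and x: "x \<in> conflict u v" and y: "y \<in> conflict u v"
  shows "x = y"
proof (cases v)
  case v: (Node c s)
  show ?thesis
  proof (cases u)
    case u: (Node c' s')
    show ?thesis
    proof (cases "c = c'")
      case True
      then show ?thesis using assms unfolding u v by (auto simp: conflict_def block_def)
    next
      case False
      then have "cadj c x" "cadj c y" "x = c' \<or> cadj c' x" "y = c' \<or> cadj c' y"
        using x y unfolding u v by (auto simp: conflict_def block_def)
      then show ?thesis using no_four_cycle[of c x y c'] False cadj_side by metis
    qed
  next
    case u: (Hub b)
    then have "cadj c x" "cadj c y" "absc x = b" "absc y = b"
      using x y unfolding u v by (auto simp: conflict_def block_def)
    then show ?thesis using cadj_unique_at by metis
  qed (use x in \<open>auto simp: conflict_def\<close>)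
next
  case v: (Hub b)
  show ?thesis
  proof (cases u)
    case u: (Node c s)
    then have "x = c \<or> cadj c x" "y = c \<or> cadj c y" "absc x = b" "absc y = b" "side x = side y"
      using x y unfolding u v by (auto simp: conflict_def block_def)
    then show ?thesis using cadj_unique_at cadj_side by metis
  next
    case (Hub b')
    then show ?thesis using assms unfolding v conflict_def by auto
  qed (use x in \<open>auto simp: conflict_def\<close>)
qed (use x in \<open>auto simp: conflict_def\<close>)

definition priv :: "vert set \<Rightarrow> vert \<Rightarrow> cell set" where
  "priv T v = cand v - (\<Union>u\<in>T - {v}. home u \<union> (cand u - home v))"

lemma two_private_cells:
  assumes T: "finite T" "T \<subseteq> V" and v: "v \<in> V" "v \<noteq> Apex"
    and card_T: "card (T - {v, Apex}) \<le> 2 * k - 1"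
  shows "\<exists>a b. a \<noteq> b \<and> a \<in> priv T v \<and> b \<in> priv T v"
proof -
  let ?T = "T - {v, Apex}"
  let ?C = "\<Union>u\<in>?T. conflict u v"
  have fin: "finite (cand v)" using cand_cells[OF v(1)] finite_cells finite_subset by blast
  then have finC: "finite ?C" using T(1) unfolding conflict_def by auto
  have "card (conflict u v) \<le> 1" if "u \<in> ?T" for u
  proof -
    have "finite (conflict u v)" using fin unfolding conflict_def by auto
    then show ?thesis
      using that conflict_unique[of u v] by (auto simp: card_le_Suc0_iff_eq)
  qed
  then have "card ?C \<le> (\<Sum>u\<in>?T. 1)"
    using T(1) by (intro order_trans[OF card_UN_le] sum_mono) auto
  then have "card ?C \<le> 2 * k - 1" using card_T by simp
  have "cand v - ?C \<subseteq> priv T v"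
  proof
    fix x assume x: "x \<in> cand v - ?C"
    have "x \<notin> home u \<union> (cand u - home v)" if "u \<in> T - {v}" for u
      using x that by (cases "u = Apex") (auto simp: conflict_def)
    then show "x \<in> priv T v" using x unfolding priv_def by auto
  qed
  then have "card (cand v - ?C) \<le> card (priv T v)"
    using fin unfolding priv_def by (intro card_mono) auto
  moreover have "card (cand v) - card ?C \<le> card (cand v - ?C)"
    by (rule diff_card_le_card_Diff[OF finC])
  ultimately have "2 \<le> card (priv T v)"
    using card_cand[OF v] \<open>card ?C \<le> 2 * k - 1\<close> k by linarith
  then obtain P where "P \<subseteq> priv T v" "card P = 2" by (meson obtain_subset_with_card_n)
  then show ?thesis unfolding card_2_iff by auto
qed

lemma priv_disjoint:
  assumes "u \<in> T" "u \<noteq> v" "v \<in> T \<or> home v = {}"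
  shows "priv T u \<inter> priv T v = {}"
  using assms unfolding priv_def by blast

definition nodes :: "cell set \<Rightarrow> vert set" where
  "nodes Z = {Node c s | c s. c \<in> Z \<and> s < n}"

lemma Node_in_nodes [simp]: "Node c s \<in> nodes Z \<longleftrightarrow> c \<in> Z \<and> s < n"
  unfolding nodes_def by auto

lemma cell_connected:
  assumes "c \<in> cells" "s < n" "t < n"
  shows "(Node c s, Node c t) \<in> (induced adj (nodes {c}))\<^sup>*"
proof -
  have up: "(Node c 0, Node c s) \<in> (induced adj (nodes {c}))\<^sup>*" if "s < n" for s
    using that
  proof (induction s)
    case (Suc s)
    then have "(Node c s, Node c (Suc s)) \<in> induced adj (nodes {c})"
      using assms(1) unfolding induced_def by auto
    with Suc show ?case by (auto intro: rtrancl_into_rtrancl)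
  qed simp
  show ?thesis
    using rtrancl_induced_sym[OF up[OF assms(2)] symp_adj] up[OF assms(3)] by (rule rtrancl_trans)
qed

lemma cells_connected:
  assumes "(a, b) \<in> (induced cadj Z)\<^sup>*" and Z: "Z \<subseteq> cells" "a \<in> Z" and st: "s < n" "t < n"
  shows "(Node a s, Node b t) \<in> (induced adj (nodes Z))\<^sup>*"
  using assms(1) st(2)
proof (induction arbitrary: t rule: rtrancl_induct)
  case base
  show ?case
    using cell_connected[of a s t] Z st base
    by (auto intro: rtrancl_induced_mono simp: nodes_def)
next
  case (step b c)
  then have bc: "b \<in> Z" "c \<in> Z" "cadj b c" unfolding induced_def by auto
  let ?s = "absc c div (2 * k)" and ?t = "absc b div (2 * k)"
  have st: "?s < n" "?t < n" using bc Z absc_div_less by auto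
  have "(Node b ?s, Node c ?t) \<in> induced adj (nodes Z)"
    using bc Z st unfolding induced_def by auto
  moreover have "(Node c ?t, Node c t) \<in> (induced adj (nodes Z))\<^sup>*"
    by (rule rtrancl_induced_mono[OF cell_connected]) (use bc Z st step.prems in \<open>auto simp: nodes_def\<close>)
  ultimately show ?case
    using step.IH[OF st(1)] by (meson rtrancl_into_rtrancl rtrancl_trans)
qed

lemma cand_reachable:
  assumes v: "v \<in> V" and a: "a \<in> cand v" and s: "s < n"
  shows "(v, Node a s) \<in> (induced adj (insert v (nodes {a})))\<^sup>*"
proof -
  have ac: "a \<in> cells" using cand_cells[OF v] a by auto
  have "\<exists>t<n. v = Node a t \<or> adj v (Node a t)"
  proof (cases v)
    case (Node c q)
    then show ?thesis using a v absc_div_less[of c] by (auto simp: block_def)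
  next
    case (Hub b)
    then show ?thesis using a v n_ge by (intro exI[of _ 0]) auto
  qed (use a in auto)
  then obtain t where t: "t < n" "v = Node a t \<or> adj v (Node a t)" by blast
  have *: "(Node a t, Node a s) \<in> (induced adj (insert v (nodes {a})))\<^sup>*"
    by (rule rtrancl_induced_mono[OF cell_connected[OF ac t(1) s]]) auto
  show ?thesis
  proof (cases "v = Node a t")
    case False
    then have "(v, Node a t) \<in> induced adj (insert v (nodes {a}))"
      using t unfolding induced_def by auto
    with * show ?thesis by (rule converse_rtrancl_into_rtrancl[rotated])
  qed (use * in simp)
qed

definition hubs :: "vert set" where
  "hubs = Hub ` {..<2 * k - 1}"

lemma card_hubs: "card hubs = 2 * k - 1"
  unfolding hubs_def by (simp add: card_image inj_on_def)

lemma home_hub: "u \<in> hubs \<Longrightarrow> home u = {}"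
  unfolding hubs_def by auto

lemma hubs_V: "hubs \<subseteq> V"
  unfolding hubs_def by auto

lemma adj_Apex_iff: "adj Apex u \<longleftrightarrow> u \<in> hubs" "adj u Apex \<longleftrightarrow> u \<in> hubs"
  unfolding hubs_def by (cases u; auto)+

lemma free_hubs:
  assumes T: "finite T" "card T = 2 * k" "Apex \<in> T" and U: "U \<subseteq> T - hubs - {Apex}"
  shows "card U \<le> card (hubs - T)"
proof -
  have fh: "finite hubs" unfolding hubs_def by simp
  have ap: "Apex \<notin> hubs" unfolding hubs_def by auto
  have finU: "finite U" using U T(1) by (auto intro: finite_subset)
  have "(T \<inter> hubs) \<union> U \<subseteq> T - {Apex}" using U ap by auto
  then have "card ((T \<inter> hubs) \<union> U) \<le> 2 * k - 1"
    using T card_mono[of "T - {Apex}" "(T \<inter> hubs) \<union> U"] by simp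
  moreover have "card ((T \<inter> hubs) \<union> U) = card (T \<inter> hubs) + card U"
    by (rule card_Un_disjoint) (use T finU U in auto)
  moreover have "card (hubs - T) + card (T \<inter> hubs) = card hubs"
    using card_Diff_subset_Int[of hubs T] card_mono[OF fh, of "hubs \<inter> T"] fh by (simp add: Int_commute)
  ultimately show ?thesis using card_hubs by linarith
qed

lemma hub_exits:
  assumes dist: "distinct vs" and len: "length vs = 2 * k"
  defines "nx \<equiv> \<lambda>i. Suc i mod (2 * k)"
  obtains h h' where
    "\<And>i. i < 2 * k \<Longrightarrow> vs ! i = Apex \<Longrightarrow> vs ! nx i \<notin> hubs \<Longrightarrow> h \<in> hubs - set vs"
    "\<And>j. j < 2 * k \<Longrightarrow> vs ! nx j = Apex \<Longrightarrow> vs ! j \<notin> hubs \<Longrightarrow> h' \<in> hubs - set vs"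
    "\<And>i j. i < 2 * k \<Longrightarrow> j < 2 * k \<Longrightarrow> vs ! i = Apex \<Longrightarrow> vs ! nx i \<notin> hubs \<Longrightarrow>
      vs ! nx j = Apex \<Longrightarrow> vs ! j \<notin> hubs \<Longrightarrow> h \<noteq> h'"
proof -
  define P where "P i \<longleftrightarrow> i < 2 * k \<and> vs ! i = Apex \<and> vs ! nx i \<notin> hubs" for i
  define Q where "Q j \<longleftrightarrow> j < 2 * k \<and> vs ! nx j = Apex \<and> vs ! j \<notin> hubs" for j
  have nx: "nx i < 2 * k" "nx i \<noteq> i" "nx (nx i) \<noteq> i" if "i < 2 * k" for i
  proof -
    show "nx i < 2 * k" using k unfolding nx_def by simp
    show "nx i \<noteq> i" "nx (nx i) \<noteq> i"
      using that k unfolding nx_def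
      by (cases "Suc i = 2 * k"; cases "Suc (Suc i) = 2 * k"; auto)+
  qed
  have eq: "vs ! i = vs ! j \<longleftrightarrow> i = j" if "i < 2 * k" "j < 2 * k" for i j
    using that dist len by (simp add: nth_eq_iff_index_eq)
  have mem: "vs ! i \<in> set vs" if "i < 2 * k" for i using that len by simp
  have cT: "card (set vs) = 2 * k" using dist len by (simp add: distinct_card)
  have "\<exists>h h'. (\<forall>i. P i \<longrightarrow> h \<in> hubs - set vs) \<and> (\<forall>j. Q j \<longrightarrow> h' \<in> hubs - set vs) \<and>
      (\<forall>i j. P i \<longrightarrow> Q j \<longrightarrow> h \<noteq> h')"
  proof (cases "\<exists>i j. P i \<and> Q j")
    case True
    then obtain i j where ij: "P i" "Q j" by blast
    then have i: "i < 2 * k" "vs ! i = Apex" "vs ! nx i \<notin> hubs"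
      and j: "j < 2 * k" "vs ! nx j = Apex" "vs ! j \<notin> hubs" unfolding P_def Q_def by auto
    then have "i = nx j" using eq nx by metis
    then have "nx i \<noteq> j" using nx j by auto
    then have ne: "vs ! nx i \<noteq> vs ! j" using eq nx i j by auto
    have "vs ! nx i \<noteq> Apex" "vs ! j \<noteq> Apex"
      using i j eq nx by metis+
    then have "{vs ! nx i, vs ! j} \<subseteq> set vs - hubs - {Apex}"
      using i j mem nx by auto
    then have "card {vs ! nx i, vs ! j} \<le> card (hubs - set vs)"
      using mem[OF i(1)] i(2) by (intro free_hubs) (auto simp: cT)
    then have "2 \<le> card (hubs - set vs)" using ne by simp
    then obtain B where "B \<subseteq> hubs - set vs" "card B = 2" by (meson obtain_subset_with_card_n)
    then show ?thesis unfolding card_2_iff by blast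
  next
    case False
    have one: "hubs - set vs \<noteq> {}" if "Apex \<in> set vs" "u \<in> set vs" "u \<notin> hubs" "u \<noteq> Apex" for u
    proof -
      have "card {u} \<le> card (hubs - set vs)"
        using that by (intro free_hubs) (auto simp: cT)
      then have "0 < card (hubs - set vs)" by simp
      then show ?thesis unfolding card_gt_0_iff by blast
    qed
    have "hubs - set vs \<noteq> {}" if "P i" for i
      using one[of "vs ! nx i"] that mem[of i] mem[of "nx i"] nx[of i] eq[of i "nx i"] unfolding P_def by auto
    moreover have "hubs - set vs \<noteq> {}" if "Q j" for j
      using one[of "vs ! j"] that mem[of j] mem[of "nx j"] nx[of j] eq[of j "nx j"] unfolding Q_def by auto
    ultimately show ?thesis using False by (metis ex_in_conv)
  qed
  then obtain h h' where hh: "\<And>i. P i \<Longrightarrow> h \<in> hubs - set vs" "\<And>j. Q j \<Longrightarrow> h' \<in> hubs - set vs"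
    "\<And>i j. P i \<Longrightarrow> Q j \<Longrightarrow> h \<noteq> h'" by blast
  show thesis by (rule that[of h h']) (rule hh; simp add: P_def Q_def)+
qed

lemma cycle_through_terminals:
  assumes len: "length vs = 2 * k" and dist: "distinct vs" and sub: "set vs \<subseteq> V"
  shows "\<exists>ws. distinct ws \<and> subseq vs ws \<and> successively adj (ws @ [hd ws])"
proof -
  define r where "r = 2 * k"
  define nx where "nx i = Suc i mod r" for i
  define T where "T = set vs"
  have r: "4 \<le> r" using k unfolding r_def by simp
  have nx: "nx i < r" for i using r unfolding nx_def by simp
  have nx_inj: "i = j" if "nx i = nx j" "i < r" "j < r" for i j
    using that unfolding nx_def by (cases "Suc i = r"; cases "Suc j = r"; auto)
  have eq: "vs ! i = vs ! j \<longleftrightarrow> i = j" if "i < r" "j < r" for i j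
    using that dist len unfolding r_def by (simp add: nth_eq_iff_index_eq)
  have mem: "vs ! i \<in> T" if "i < r" for i using that len unfolding r_def T_def by simp
  have T: "finite T" "T \<subseteq> V" "card T = 2 * k"
    using sub dist len unfolding T_def by (auto simp: distinct_card)
  obtain h h' where hh: "\<And>i. i < r \<Longrightarrow> vs ! i = Apex \<Longrightarrow> vs ! nx i \<notin> hubs \<Longrightarrow> h \<in> hubs - T"
    "\<And>j. j < r \<Longrightarrow> vs ! nx j = Apex \<Longrightarrow> vs ! j \<notin> hubs \<Longrightarrow> h' \<in> hubs - T"
    "\<And>i j. i < r \<Longrightarrow> j < r \<Longrightarrow> vs ! i = Apex \<Longrightarrow> vs ! nx i \<notin> hubs \<Longrightarrow>
      vs ! nx j = Apex \<Longrightarrow> vs ! j \<notin> hubs \<Longrightarrow> h \<noteq> h'"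
    using hub_exits[OF dist len, folded r_def, folded nx_def T_def] by blast
  define J where "J = {i. i < r \<and> \<not> (vs ! i = Apex \<and> vs ! nx i \<in> hubs) \<and>
    \<not> (vs ! nx i = Apex \<and> vs ! i \<in> hubs)}"
  define S where "S i = (if vs ! i = Apex then h else vs ! i)" for i
  define S' where "S' i = (if vs ! nx i = Apex then h' else vs ! nx i)" for i
  have J: "i < r" if "i \<in> J" for i using that unfolding J_def by simp
  have S: "S i = vs ! i \<and> vs ! i \<in> T - {Apex} \<or> vs ! i = Apex \<and> S i = h \<and> h \<in> hubs - T" if "i \<in> J" for i
    using that hh(1)[of i] mem[of i] unfolding J_def S_def by auto
  have S': "S' i = vs ! nx i \<and> vs ! nx i \<in> T - {Apex} \<or> vs ! nx i = Apex \<and> S' i = h' \<and> h' \<in> hubs - T"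
    if "i \<in> J" for i
    using that hh(2)[of i] mem[of "nx i"] nx[of i] unfolding J_def S'_def by auto
  have hne: "h \<noteq> h'" if "i \<in> J" "j \<in> J" "vs ! i = Apex" "vs ! nx j = Apex" for i j
    using that hh(3)[of i j] unfolding J_def by auto
  define E where "E = (T - {Apex}) \<union> {u \<in> hubs - T. Apex \<in> T}"
  have SE: "S i \<in> E" if "i \<in> J" for i
    using S[OF that] mem[OF J[OF that]] unfolding E_def by auto
  have SE': "S' i \<in> E" if "i \<in> J" for i
    using S'[OF that] mem[OF nx[of i]] unfolding E_def by auto
  have EV: "e \<in> V" "e \<noteq> Apex" if "e \<in> E" for e
    using that T hubs_V unfolding E_def hubs_def by auto
  have "\<exists>a b. a \<noteq> b \<and> a \<in> priv T e \<and> b \<in> priv T e" if e: "e \<in> E" for e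
  proof -
    have "card (T - {e, Apex}) \<le> 2 * k - 1"
    proof (cases "e \<in> T")
      case True
      have "card (T - {e, Apex}) \<le> card (T - {e})" using T by (intro card_mono) auto
      then show ?thesis using True T by simp
    next
      case False
      then have "Apex \<in> T" using e unfolding E_def by auto
      moreover have "card (T - {e, Apex}) \<le> card (T - {Apex})" using T by (intro card_mono) auto
      ultimately show ?thesis using T by simp
    qed
    then show ?thesis using two_private_cells[OF T(1,2) EV[OF e]] by blast
  qed
  then obtain f g where fg: "\<And>e. e \<in> E \<Longrightarrow> f e \<noteq> g e" "\<And>e. e \<in> E \<Longrightarrow> f e \<in> priv T e"
    "\<And>e. e \<in> E \<Longrightarrow> g e \<in> priv T e"
    by metis
  have pdisj: "priv T d \<inter> priv T e = {}" if "d \<in> E" "e \<in> E" "d \<noteq> e" for d e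
  proof (cases "d \<in> T \<or> e \<in> T")
    case True
    have "x \<in> T \<or> home x = {}" if "x \<in> E" for x
      using that home_hub unfolding E_def by auto
    then show ?thesis using True that priv_disjoint[of d T e] priv_disjoint[of e T d] by blast
  next
    case False
    then show ?thesis using that unfolding E_def hubs_def priv_def by auto
  qed
  \<comment> \<open>The dummy value \<open>c0\<close> is only there to have total functions: indices outside \<open>J\<close> are those
    where an edge between the apex and a hub is the link.\<close>
  define c0 where "c0 = Cell False 0 0"
  have c0: "c0 \<in> cells" using hub_cells[of 0] k unfolding c0_def by auto
  define a where "a i = (if i \<in> J then f (S i) else c0)" for i
  define b where "b i = (if i \<in> J then g (S' i) else c0)" for i
  have ap: "a i \<in> priv T (S i)" if "i \<in> J" for i using that fg SE unfolding a_def by simp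
  have bp: "b i \<in> priv T (S' i)" if "i \<in> J" for i using that fg SE' unfolding b_def by simp
  have priv_cells: "priv T e \<subseteq> cells" if "e \<in> E" for e
    using cand_cells[OF EV(1)[OF that]] unfolding priv_def by auto
  have ac: "a i \<in> cells" for i
    using ap[of i] SE[of i] priv_cells[of "S i"] c0 by (cases "i \<in> J") (auto simp: a_def)
  have bc: "b i \<in> cells" for i
    using bp[of i] SE'[of i] priv_cells[of "S' i"] c0 by (cases "i \<in> J") (auto simp: b_def)
  have S_inj: "S i \<noteq> S j" if "i \<in> J" "j \<in> J" "i \<noteq> j" for i j
    using S[OF that(1)] S[OF that(2)] eq[OF J J, OF that(1,2)] that(3) by auto
  have S'_inj: "S' i \<noteq> S' j" if "i \<in> J" "j \<in> J" "i \<noteq> j" for i j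
    using S'[OF that(1)] S'[OF that(2)] eq[OF nx nx, of i j] nx_inj[of i j] J that by auto
  have aa: "a i \<noteq> a j" if "i \<in> J" "j \<in> J" "i \<noteq> j" for i j
    using pdisj[OF SE SE S_inj, of i j] that ap[of i] ap[of j] by auto
  have bb: "b i \<noteq> b j" if "i \<in> J" "j \<in> J" "i \<noteq> j" for i j
    using pdisj[OF SE' SE' S'_inj, of i j] that bp[of i] bp[of j] by auto
  have ab: "a i \<noteq> b j" if "i \<in> J" "j \<in> J" for i j
  proof (cases "S i = S' j")
    case True
    then show ?thesis using fg(1)[OF SE[OF that(1)]] that unfolding a_def b_def by simp
  next
    case False
    then show ?thesis using pdisj[OF SE SE' False] that ap[of i] bp[of j] by auto
  qed
  have a_home: "u = S i" if "i \<in> J" "u \<in> T" "a i \<in> home u" for i u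
    using ap[OF that(1)] that unfolding priv_def by auto
  have b_home: "u = S' i" if "i \<in> J" "u \<in> T" "b i \<in> home u" for i u
    using bp[OF that(1)] that unfolding priv_def by auto
  define F where "F = (\<Union>u\<in>T. home u) \<union> a ` {..<r} \<union> b ` {..<r}"
  have finF: "finite F"
  proof -
    have "finite (home u)" for u by (cases u) auto
    then show ?thesis unfolding F_def using T(1) by auto
  qed
  have "card F \<le> 6 * k"
  proof -
    have "card (home u) \<le> 1" for u by (cases u) auto
    then have "card (\<Union>u\<in>T. home u) \<le> (\<Sum>u\<in>T. 1)"
      using T(1) by (intro order_trans[OF card_UN_le] sum_mono) auto
    then have "card (\<Union>u\<in>T. home u) \<le> 2 * k" using T(3) by simp
    moreover have "card (a ` {..<r}) \<le> 2 * k" "card (b ` {..<r}) \<le> 2 * k"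
      using card_image_le[of "{..<r}"] unfolding r_def by (metis card_lessThan finite_lessThan)+
    moreover have "card F \<le> card (\<Union>u\<in>T. home u) + card (a ` {..<r}) + card (b ` {..<r})"
      unfolding F_def by (meson card_Un_le order_trans add_le_mono1)
    ultimately show ?thesis by linarith
  qed
  then have "2 * (card F + 3 * r) + 2 * k + 1 \<le> 26 * k + 1" unfolding r_def by simp
  then have bound: "2 * (card F + 3 * r) + 2 * k + 1 < M" using M_large k by linarith
  from disjoint_cell_links[of r a b, OF ac bc finF bound] obtain I where I:
    "\<forall>i<r. I i \<subseteq> cells \<and> I i \<inter> F = {} \<and> card (I i) \<le> 3 \<and>
      (a i, b i) \<in> (induced cadj (insert (a i) (insert (b i) (I i))))\<^sup>*"
    "\<forall>i<r. \<forall>j<r. i \<noteq> j \<longrightarrow> I i \<inter> I j = {}"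
    by (elim exE conjE)
  have I: "\<And>i. i < r \<Longrightarrow> I i \<subseteq> cells" "\<And>i. i < r \<Longrightarrow> I i \<inter> F = {}"
    "\<And>i. i < r \<Longrightarrow> (a i, b i) \<in> (induced cadj (insert (a i) (insert (b i) (I i))))\<^sup>*"
    "\<And>i j. i < r \<Longrightarrow> j < r \<Longrightarrow> i \<noteq> j \<Longrightarrow> I i \<inter> I j = {}"
    using I by simp_all
  define Z where "Z i = insert (a i) (insert (b i) (I i))" for i
  have Zdisj: "Z i \<inter> Z j = {}" if "i \<in> J" "j \<in> J" "i \<noteq> j" for i j
  proof -
    have F: "a i \<in> F" "b i \<in> F" "a j \<in> F" "b j \<in> F" using that J unfolding F_def by auto
    have "I i \<inter> F = {}" "I j \<inter> F = {}" "I i \<inter> I j = {}" using I that J by auto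
    then show ?thesis
      using F aa[OF that] bb[OF that] ab[OF that(1,2)] ab[OF that(2,1)] unfolding Z_def by auto
  qed
  have Zhome: "u = S i \<or> u = S' i" if "i \<in> J" "u \<in> T" "c \<in> home u" "c \<in> Z i" for i u c
  proof -
    have "c \<in> F" using that unfolding F_def by auto
    then have "c = a i \<or> c = b i" using that I(2)[OF J[OF that(1)]] unfolding Z_def by auto
    then show ?thesis using a_home b_home that by blast
  qed
  define W where "W i = {vs ! i, vs ! nx i} \<union> (if i \<in> J then {S i, S' i} \<union> nodes (Z i) else {})" for i
  show ?thesis
  proof (rule cycle_of_disjoint_links[where vs = vs and E = adj and W = W, unfolded len, folded r_def, folded nx_def, OF dist])
    show "2 \<le> r" using r by simp
  next
    fix i assume i: "i < r"
    show "(vs ! i, vs ! nx i) \<in> (induced adj (W i))\<^sup>*"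
    proof (cases "i \<in> J")
      case False
      then have "adj (vs ! i) (vs ! nx i)" using i adj_Apex_iff unfolding J_def by auto
      then show ?thesis unfolding induced_def W_def by auto
    next
      case True
      have n0: "0 < n" using n_ge by simp
      have 1: "(vs ! i, S i) \<in> (induced adj (W i))\<^sup>*"
        using S[OF True] True adj_Apex_iff unfolding induced_def W_def by auto
      have 5: "(S' i, vs ! nx i) \<in> (induced adj (W i))\<^sup>*"
        using S'[OF True] True adj_Apex_iff unfolding induced_def W_def by auto
      have 2: "(S i, Node (a i) 0) \<in> (induced adj (W i))\<^sup>*"
        by (rule rtrancl_induced_mono[OF cand_reachable[OF EV(1)[OF SE[OF True]] _ n0]])
          (use ap[OF True] True in \<open>auto simp: priv_def W_def Z_def nodes_def\<close>)
      have "(S' i, Node (b i) 0) \<in> (induced adj (W i))\<^sup>*"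
        by (rule rtrancl_induced_mono[OF cand_reachable[OF EV(1)[OF SE'[OF True]] _ n0]])
          (use bp[OF True] True in \<open>auto simp: priv_def W_def Z_def nodes_def\<close>)
      then have 4: "(Node (b i) 0, S' i) \<in> (induced adj (W i))\<^sup>*"
        by (rule rtrancl_induced_sym[OF _ symp_adj])
      have "Z i \<subseteq> cells" using ac bc I(1)[OF i] unfolding Z_def by auto
      then have 3: "(Node (a i) 0, Node (b i) 0) \<in> (induced adj (W i))\<^sup>*"
        by (intro rtrancl_induced_mono[OF cells_connected[OF I(3)[OF i, folded Z_def] _ _ n0 n0]])
          (use True in \<open>auto simp: W_def Z_def\<close>)
      from 1 2 3 4 5 show ?thesis by (meson rtrancl_trans)
    qed
    show "set vs \<inter> W i \<subseteq> {vs ! i, vs ! nx i}"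
    proof
      fix x assume x: "x \<in> set vs \<inter> W i"
      show "x \<in> {vs ! i, vs ! nx i}"
      proof (rule ccontr)
        assume no: "x \<notin> {vs ! i, vs ! nx i}"
        then have iJ: "i \<in> J" and xW: "x \<in> {S i, S' i} \<union> nodes (Z i)"
          using x unfolding W_def by (auto split: if_splits)
        have "x = S i \<or> x = S' i"
        proof (cases "x \<in> nodes (Z i)")
          case True
          then obtain c q where "x = Node c q" "c \<in> Z i" unfolding nodes_def by auto
          then show ?thesis using Zhome[OF iJ, of x c] x unfolding T_def by auto
        qed (use xW in auto)
        then show False using S[OF iJ] S'[OF iJ] no x unfolding T_def by auto
      qed
    qed
  next
    fix i j assume ij: "i < r" "j < r" "i \<noteq> j"
    show "W i \<inter> W j \<subseteq> set vs"
    proof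
      fix x assume x: "x \<in> W i \<inter> W j"
      show "x \<in> set vs"
      proof (rule ccontr)
        assume "x \<notin> set vs"
        then have xT: "x \<notin> T" unfolding T_def by simp
        have *: "l \<in> J \<and> (x \<in> nodes (Z l) \<or> x \<in> hubs \<and> (x = h \<and> vs ! l = Apex \<or> x = h' \<and> vs ! nx l = Apex))"
          if "x \<in> W l" "l < r" for l
        proof -
          have "l \<in> J" "x \<in> {S l, S' l} \<union> nodes (Z l)"
            using that xT mem[OF that(2)] mem[OF nx, of l] unfolding W_def by (auto split: if_splits)
          then show ?thesis using S[of l] S'[of l] xT by auto
        qed
        have iJ: "i \<in> J" "j \<in> J" using * x ij by blast+
        have nh: "nodes Y \<inter> hubs = {}" for Y unfolding nodes_def hubs_def by auto
        show False
        proof (cases "x \<in> hubs")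
          case True
          then consider "x = h" "vs ! i = Apex" | "x = h'" "vs ! nx i = Apex"
            using *[of i] x ij nh by blast
          moreover have "x = h \<and> vs ! j = Apex \<or> x = h' \<and> vs ! nx j = Apex"
            using True *[of j] x ij nh by blast
          ultimately show False
            using hne[OF iJ] hne[OF iJ(2,1)] eq[OF ij(1,2)] eq[OF nx nx, of i j] nx_inj[of i j] ij
            by cases auto
        next
          case False
          then have "x \<in> nodes (Z i)" "x \<in> nodes (Z j)" using *[of i] *[of j] x ij by auto
          then show False using Zdisj[OF iJ ij(3)] unfolding nodes_def by auto
        qed
      qed
    qed
  qed
qed

definition G :: "nat pair_pre_digraph" where
  "G = image_graph to_nat V adj"

lemma pair_graph_G: "pair_graph G"
  unfolding G_def by (intro pair_graph_image_graph finite_V symp_adj irreflp_adj inj_to_nat)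

lemma r_ordered_G: "r_ordered (2 * k) G"
  unfolding G_def using k
  by (intro r_ordered_image_graph inj_to_nat adj_in_V cycle_through_terminals) auto

lemma degree_bounds:
  assumes "v \<in> V"
  shows "2 * k - 1 \<le> card {w \<in> V. adj v w}" "card {w \<in> V. adj v w} \<le> 2 * k + 2"
proof (atomize (full), cases v)
  case (Node c s)
  then show "2 * k - 1 \<le> card {w \<in> V. adj v w} \<and> card {w \<in> V. adj v w} \<le> 2 * k + 2"
    using assms degree_node[of c s] by simp
qed (use assms degree_hub degree_apex in auto)

lemma degrees_G:
  "out_degree (with_proj G) ` pverts G = (\<lambda>v. card {w \<in> V. adj v w}) ` V"
  unfolding G_def by (force simp: image_image out_degree_image_graph)

lemma min_degree_G: "min_degree G = 2 * k - 1"
  unfolding min_degree_def degrees_G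
proof (rule Min_eqI)
  show "2 * k - 1 \<in> (\<lambda>v. card {w \<in> V. adj v w}) ` V"
    using degree_apex by (intro image_eqI[of _ _ Apex]) auto
qed (use finite_V degree_bounds in auto)

lemma max_degree_G: "max_degree G = 2 * k + 2"
  unfolding max_degree_def degrees_G
proof (rule Max_eqI)
  show "2 * k + 2 \<in> (\<lambda>v. card {w \<in> V. adj v w}) ` V"
    using degree_hub[of 0] k by (intro image_eqI[of _ _ "Hub 0"]) auto
qed (use finite_V degree_bounds in auto)

lemma card_cells: "card cells = 2 * (M * p)"
proof -
  have "cells = (\<lambda>(s, x, y). Cell s x y) ` (UNIV \<times> {..<M} \<times> {..<p})"
  proof (intro equalityI subsetI)
    fix c assume "c \<in> cells"
    then show "c \<in> (\<lambda>(s, x, y). Cell s x y) ` (UNIV \<times> {..<M} \<times> {..<p})"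
      unfolding cells_def plane_def by (cases c) force
  qed (use M_le in \<open>auto simp: cells_def plane_def\<close>)
  moreover have "inj_on (\<lambda>(s, x, y). Cell s x y) (UNIV \<times> {..<M} \<times> {..<p})"
    by (auto simp: inj_on_def)
  ultimately show ?thesis by (simp add: card_image card_cartesian_product)
qed

lemma card_verts_G: "card (pverts G) = 2 * (M * p) * n + 2 * k"
proof -
  have "card V = card cells * n + (2 * k - 1) + 1"
  proof -
    have "card ((\<lambda>(c, s). Node c s) ` (cells \<times> {..<n})) = card cells * n"
      by (subst card_image) (auto simp: inj_on_def card_cartesian_product)
    moreover have "card (Hub ` {..<2 * k - 1}) = 2 * k - 1"
      by (simp add: card_image inj_on_def)
    ultimately show ?thesis
      unfolding V_def using finite_cells
      by (subst card_Un_disjoint; (subst card_Un_disjoint)?) auto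
  qed
  then show ?thesis unfolding G_def using k by (simp add: card_image card_cells)
qed

end

lemma card_verts_G_less:
  assumes "cell_plane k p" "cell_plane k q" "p < q"
  shows "card (pverts (cell_plane.G k p)) < card (pverts (cell_plane.G k q))"
proof -
  interpret P: cell_plane k p by fact
  interpret Q: cell_plane k q by fact
  have n: "P.n \<le> Q.n" unfolding P.n_def Q.n_def using assms(3) by (intro div_le_mono) simp
  then have "P.M * P.n \<le> Q.M * Q.n" unfolding P.M_def Q.M_def by (intro mult_le_mono) auto
  moreover have "0 < Q.M * Q.n" using Q.M_large Q.n_ge by auto
  ultimately have "P.M * P.n * p < Q.M * Q.n * q"
    using assms(3) by (meson le_less_trans mult_le_mono1 mult_less_mono2)
  then show ?thesis unfolding P.card_verts_G Q.card_verts_G by (simp add: algebra_simps)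
qed

theorem theorem4p4:
  fixes k :: nat
  assumes "2 \<le> k"
  shows "\<exists>F :: nat pair_pre_digraph set.
           infinite F \<and>
           pairwise (\<lambda>G H. \<not> digraph_iso (with_proj G) (with_proj H)) F \<and>
           (\<forall>G\<in>F. pair_graph G \<and> r_ordered (2 * k) G \<and>
              min_degree G = 2 * k - 1 \<and> max_degree G = 2 * k + 2)"
proof -
  define Q where "Q = {p. prime p \<and> 40 * k \<le> p}"
  have plane: "cell_plane k p" if "p \<in> Q" for p
    using that assms unfolding Q_def by unfold_locales auto
  have ne: "card (pverts (cell_plane.G k p)) \<noteq> card (pverts (cell_plane.G k q))"
    if "p \<in> Q" "q \<in> Q" "p \<noteq> q" for p q
    using card_verts_G_less[OF plane plane, of p q] card_verts_G_less[OF plane plane, of q p] that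
    by (cases "p < q") auto
  let ?F = "cell_plane.G k ` Q"
  have "infinite Q"
  proof
    assume "finite Q"
    moreover have "{p. prime p} \<subseteq> Q \<union> {..<40 * k}" unfolding Q_def by auto
    ultimately show False using primes_infinite by (meson finite_UnI finite_lessThan finite_subset)
  qed
  moreover have "inj_on (cell_plane.G k) Q" using ne by (auto intro!: inj_onI) metis
  ultimately have "infinite ?F" using finite_imageD by blast
  moreover have "pairwise (\<lambda>G H. \<not> digraph_iso (with_proj G) (with_proj H)) ?F"
    unfolding pairwise_def using ne digraph_iso_card_verts by fastforce
  moreover have "\<forall>G\<in>?F. pair_graph G \<and> r_ordered (2 * k) G \<and>
      min_degree G = 2 * k - 1 \<and> max_degree G = 2 * k + 2"
    using plane cell_plane.pair_graph_G cell_plane.r_ordered_G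
      cell_plane.min_degree_G cell_plane.max_degree_G by auto
  ultimately show ?thesis by blast
qed

end
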